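(* Let $\Delta$ be a simplicial complex on the vertex set $\{1,\dots,\ell\}$, let $j\ge 0$ be an integer, and let $q=2$. For $i\ge 0$ let $f_i$ be the number of faces $\sigma\in\Delta$ with $|\sigma|=i$ (so $f_0=1$). Then the dimension of the binary simplicial evaluation code $C(\mathcal{A}_\Delta,j)$ is $$k=\sum_{i=0}^{s} f_i,\qquad s=\min\bigl(j,\max\{|\sigma| : \sigma\in\Delta\}\bigr).$$
   Context: A simplicial complex $\Delta$ on $[\ell]=\{1,\dots,\ell\}$ is a set of subsets of $[\ell]$ (called faces) that is closed under taking subsets and contains $\{x\}$ for every $x\in[\ell]$; the empty set is a face. Fix a basis $\mathbf{b}_1,\dots,\mathbf{b}_\ell$ of $\mathbb{F}_2^\ell$ with corresponding coordinate functions $x_1,\dots,x_\ell$, and for $\sigma\subseteq[\ell]$ let $X_\sigma=\mathrm{span}\{\mathbf{b}_i : i\in\sigma\}$. The coordinate subspace arrangement of $\Delta$ is $\mathcal{A}_\Delta=\{X_\sigma : \sigma\in\Delta\}$, with set of points $P(\mathcal{A}_\Delta)=\bigcup_{\sigma\in\Delta}X_\sigma=\{p_1,\dots,p_n\}$. The binary simplicial evaluation code $C(\mathcal{A}_\Delta,j)\subseteq\mathbb{F}_2^n$ is the image of the linear map $f\mapsto (f(p_1),\dots,f(p_n))$ on the space of all polynomials of total degree at most $j$ in $\mathbb{F}_2[x_1,\dots,x_\ell]$. *)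

theory Defs
  imports
    "HOL-Library.Z2"
    "HOL-Library.Poly_Mapping"
    "Jordan_Normal_Form.VS_Connect"
begin

text \<open>The field with two elements is \<^typ>\<open>bit\<close>; the vector space of all \<open>n\<close>-tuples over it is
  \<open>F2_space n\<close>.\<close>

abbreviation F2 :: "bit ring"
  where "F2 \<equiv> class_ring"

abbreviation F2_space :: "nat \<Rightarrow> (bit, bit vec) module"
  where "F2_space n \<equiv> module_vec TYPE(bit) n"

definition F2_basis :: "nat \<Rightarrow> (nat \<Rightarrow> bit vec) \<Rightarrow> bool"
  where "F2_basis l b \<longleftrightarrow>
    inj_on b {1..l} \<and> vectorspace.basis F2 (F2_space l) (b ` {1..l})"

text \<open>\<open>coordinate l b v i\<close> is the value at \<open>v\<close> of the coordinate function \<open>x\<^sub>i\<close> dual to the basis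
  \<open>b 1, \<dots>, b l\<close>. Indices outside \<open>{1..l}\<close> get the value 0, which makes the description unique.\<close>

definition coordinate :: "nat \<Rightarrow> (nat \<Rightarrow> bit vec) \<Rightarrow> bit vec \<Rightarrow> nat \<Rightarrow> bit"
  where "coordinate l b v = (THE c. (\<forall>i. i \<notin> {1..l} \<longrightarrow> c i = 0) \<and>
    v = finsum_vec TYPE(bit) l (\<lambda>i. c i \<cdot>\<^sub>v b i) {1..l})"

text \<open>The empty face has to be required: it follows from the other conditions only for \<open>l > 0\<close>.\<close>

definition simplicial_complex :: "nat \<Rightarrow> nat set set \<Rightarrow> bool"
  where "simplicial_complex l \<Delta> \<longleftrightarrow>
    \<Delta> \<subseteq> Pow {1..l} \<and> {} \<in> \<Delta> \<and>
    (\<forall>\<sigma>\<in>\<Delta>. \<forall>\<tau>. \<tau> \<subseteq> \<sigma> \<longrightarrow> \<tau> \<in> \<Delta>) \<and>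
    (\<forall>x\<in>{1..l}. {x} \<in> \<Delta>)"

definition face_number :: "nat set set \<Rightarrow> nat \<Rightarrow> nat"
  where "face_number \<Delta> i = card {\<sigma>\<in>\<Delta>. card \<sigma> = i}"

definition coordinate_subspace :: "nat \<Rightarrow> (nat \<Rightarrow> bit vec) \<Rightarrow> nat set \<Rightarrow> bit vec set"
  where "coordinate_subspace l b \<sigma> = LinearCombinations.module.span F2 (F2_space l) (b ` \<sigma>)"

definition coordinate_arrangement :: "nat \<Rightarrow> (nat \<Rightarrow> bit vec) \<Rightarrow> nat set set \<Rightarrow> bit vec set set"
  where "coordinate_arrangement l b \<Delta> = coordinate_subspace l b ` \<Delta>"

definition arrangement_points :: "bit vec set set \<Rightarrow> bit vec set"
  where "arrangement_points \<A> = \<Union>\<A>"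

text \<open>A multivariate polynomial is a finitely supported map from monomials (finitely supported
  exponent maps) to coefficients; the indeterminates are indexed by natural numbers.\<close>

type_synonym F2_mpoly = "(nat \<Rightarrow>\<^sub>0 nat) \<Rightarrow>\<^sub>0 bit"

definition indeterminates :: "F2_mpoly \<Rightarrow> nat set"
  where "indeterminates f = (\<Union>m\<in>Poly_Mapping.keys f. Poly_Mapping.keys m)"

definition monomial_degree :: "(nat \<Rightarrow>\<^sub>0 nat) \<Rightarrow> nat"
  where "monomial_degree m = (\<Sum>i\<in>Poly_Mapping.keys m. Poly_Mapping.lookup m i)"

text \<open>The zero polynomial has total degree 0 here, so it satisfies every degree bound.\<close>

definition total_degree :: "F2_mpoly \<Rightarrow> nat"
  where "total_degree f = Max (insert 0 (monomial_degree ` Poly_Mapping.keys f))"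

definition mpoly_eval :: "F2_mpoly \<Rightarrow> (nat \<Rightarrow> bit) \<Rightarrow> bit"
  where "mpoly_eval f a =
    (\<Sum>m\<in>Poly_Mapping.keys f. Poly_Mapping.lookup f m *
       (\<Prod>i\<in>Poly_Mapping.keys m. a i ^ Poly_Mapping.lookup m i))"

text \<open>\<open>evaluation_code l b ps j\<close> is the evaluation code of degree \<open>j\<close> at the list of points
  \<open>ps = [p\<^sub>1, \<dots>, p\<^sub>n]\<close>, where \<open>f(p)\<close> is obtained by substituting the coordinates of \<open>p\<close>
  with respect to the basis \<open>b\<close>.\<close>

definition evaluation_code :: "nat \<Rightarrow> (nat \<Rightarrow> bit vec) \<Rightarrow> bit vec list \<Rightarrow> nat \<Rightarrow> bit vec set"
  where "evaluation_code l b ps j =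
    (\<lambda>f. vec_of_list (map (\<lambda>p. mpoly_eval f (coordinate l b p)) ps)) `
      {f. indeterminates f \<subseteq> {1..l} \<and> total_degree f \<le> j}"

definition code_dimension :: "nat \<Rightarrow> bit vec set \<Rightarrow> nat"
  where "code_dimension n C = vectorspace.dim F2 (F2_space n\<lparr>carrier := C\<rparr>)"

end

theory Submission
  imports Defs "Jordan_Normal_Form.DL_Rank"
begin

text \<open>A point of the arrangement is determined by its support, which ranges over exactly the faces
  of \<open>\<Delta>\<close>. On the point with support \<open>\<sigma>\<close>, a monomial with set of variables \<open>\<tau>\<close> evaluates to
  \<open>[\<tau> \<subseteq> \<sigma>]\<close>, so it vanishes everywhere unless \<open>\<tau> \<in> \<Delta>\<close>, and the code is spanned by the
  vectors \<open>([\<tau> \<subseteq> \<sigma>])\<^sub>\<sigma>\<close> with \<open>\<tau> \<in> \<Delta>\<close> and \<open>|\<tau>| \<le> j\<close>. These are linearly independent because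
  the incidence matrix \<open>[\<tau> \<subseteq> \<sigma>]\<close> is unitriangular with respect to inclusion.\<close>

text \<open>An independent \<open>S\<close> is itself the maximal independent subset of
  \<open>S\<close> that \<open>dim_span\<close> asks for.\<close>

lemma (in vectorspace) dim_span_lin_indpt:
  assumes "S \<subseteq> carrier V" "finite S" "lin_indpt S"
  shows "vectorspace.dim K (span_vs S) = card S"
  by (rule dim_span[OF assms(1,2)]) (use assms(3) in \<open>auto simp: maximal_def\<close>)

lemma bit_eq_of_bool: "(x :: bit) = of_bool (x \<noteq> 0)"
  by (cases x) auto

section \<open>Coordinates with respect to a basis\<close>

lemma F2_basisD:
  assumes "F2_basis l b"
  shows "inj_on b {1..l}"
    and "\<And>i. i \<in> {1..l} \<Longrightarrow> b i \<in> carrier_vec l"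
    and "LinearCombinations.module.lin_indpt F2 (F2_space l) (b ` {1..l})"
proof -
  interpret V: vec_space "TYPE(bit)" l .
  have "V.basis (b ` {1..l})" and inj: "inj_on b {1..l}"
    using assms unfolding F2_basis_def by blast+
  then have "V.lin_indpt (b ` {1..l})" "b ` {1..l} \<subseteq> carrier_vec l"
    unfolding V.basis_def by blast+
  with inj show "inj_on b {1..l}" "\<And>i. i \<in> {1..l} \<Longrightarrow> b i \<in> carrier_vec l"
    "V.lin_indpt (b ` {1..l})" by blast+
qed

text \<open>Reindexing along the injective \<open>b\<close> links sums over indices with
  \<open>lincomb\<close>, whose coefficients are attached to vectors.\<close>

lemma sum_vec_basis_eq_lincomb:
  assumes b: "F2_basis l b" and \<sigma>: "\<sigma> \<subseteq> {1..l}"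
  shows "finsum_vec TYPE(bit) l (\<lambda>i. a (b i) \<cdot>\<^sub>v b i) \<sigma> =
    LinearCombinations.module.lincomb (F2_space l) a (b ` \<sigma>)"
proof -
  interpret V: vec_space "TYPE(bit)" l .
  have inj: "inj_on b \<sigma>" and C: "b ` \<sigma> \<subseteq> carrier_vec l"
    using F2_basisD(1,2)[OF b] \<sigma> by (blast intro: inj_on_subset)+
  have "V.lincomb a (b ` \<sigma>) = finsum V.V (\<lambda>i. a (b i) \<cdot>\<^sub>v b i) \<sigma>"
    unfolding V.lincomb_def by (subst V.finsum_reindex) (use inj C in auto)
  then show ?thesis by simp
qed

text \<open>Two coefficient families with the same sum differ by a vanishing combination of
  independent vectors. This uniqueness is what evaluates the definite description in
  \<open>coordinate\<close>.\<close>

lemma coordinate_sum_vec: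
  assumes b: "F2_basis l b" and c: "\<And>i. i \<notin> {1..l} \<Longrightarrow> c i = 0"
  shows "coordinate l b (finsum_vec TYPE(bit) l (\<lambda>i. c i \<cdot>\<^sub>v b i) {1..l}) = c"
proof -
  interpret V: vec_space "TYPE(bit)" l .
  note inj = F2_basisD(1)[OF b] and bC = F2_basisD(2)[OF b] and li = F2_basisD(3)[OF b]
  have C: "b ` {1..l} \<subseteq> carrier_vec l" using bC by blast
  have "d = c" if d: "\<forall>i. i \<notin> {1..l} \<longrightarrow> d i = 0"
    and eq: "finsum_vec TYPE(bit) l (\<lambda>i. c i \<cdot>\<^sub>v b i) {1..l} =
      finsum_vec TYPE(bit) l (\<lambda>i. d i \<cdot>\<^sub>v b i) {1..l}" for d
  proof
    fix i
    \<comment> \<open>\<open>lincomb\<close> expects coefficients on vectors, so the index is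
      recovered from the vector by inverting \<open>b\<close>.\<close>
    let ?e = "\<lambda>v. c (inv_into {1..l} b v) - d (inv_into {1..l} b v)"
    have "V.lincomb ?e (b ` {1..l}) = 0\<^sub>v l"
    proof (rule eq_vecI)
      show "dim_vec (V.lincomb ?e (b ` {1..l})) = dim_vec (0\<^sub>v l :: bit vec)"
        using V.lincomb_dim[OF _ C] by simp
      fix k assume "k < dim_vec (0\<^sub>v l :: bit vec)"
      then have k: "k < l" by simp
      have "finsum_vec TYPE(bit) l (\<lambda>i. c i \<cdot>\<^sub>v b i) {1..l} $ k = (\<Sum>i\<in>{1..l}. (c i \<cdot>\<^sub>v b i) $ k)"
        "finsum_vec TYPE(bit) l (\<lambda>i. d i \<cdot>\<^sub>v b i) {1..l} $ k = (\<Sum>i\<in>{1..l}. (d i \<cdot>\<^sub>v b i) $ k)"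
        by (rule index_finsum_vec; use k bC in auto)+
      with eq have "(\<Sum>i\<in>{1..l}. (c i \<cdot>\<^sub>v b i) $ k) = (\<Sum>i\<in>{1..l}. (d i \<cdot>\<^sub>v b i) $ k)"
        by simp
      moreover have "V.lincomb ?e (b ` {1..l}) $ k = (\<Sum>i\<in>{1..l}. (c i - d i) * b i $ k)"
        unfolding V.lincomb_index[OF k C] sum.reindex[OF inj] comp_def
        by (rule sum.cong) (simp_all only: inv_into_f_f[OF inj])
      moreover have "(\<Sum>i\<in>{1..l}. (c i - d i) * b i $ k) =
          (\<Sum>i\<in>{1..l}. (c i \<cdot>\<^sub>v b i) $ k) - (\<Sum>i\<in>{1..l}. (d i \<cdot>\<^sub>v b i) $ k)"
        unfolding sum_subtractf[symmetric]
      proof (rule sum.cong)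
        fix i assume "i \<in> {1..l}"
        then have "(x \<cdot>\<^sub>v b i) $ k = x * b i $ k" for x
          using carrier_vecD[OF bC] k by simp
        then show "(c i - d i) * b i $ k = (c i \<cdot>\<^sub>v b i) $ k - (d i \<cdot>\<^sub>v b i) $ k"
          by (simp only: left_diff_distrib)
      qed simp
      ultimately show "V.lincomb ?e (b ` {1..l}) $ k = 0\<^sub>v l $ k"
        using k by simp
    qed
    then have "?e v = 0" if "v \<in> b ` {1..l}" for v
      using li that unfolding V.lin_dep_def by blast
    from this[of "b i"] inj have "i \<in> {1..l} \<Longrightarrow> c i - d i = 0" by simp
    \<comment> \<open>Outside \<open>{1..l}\<close> both families are 0 by convention.\<close>
    then show "d i = c i"
      using c d by (metis eq_iff_diff_eq_0)
  qed
  then show ?thesis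
    unfolding coordinate_def by (intro the_equality) (use c in auto)
qed

section \<open>Points of the arrangement and their supports\<close>

definition support :: "nat \<Rightarrow> (nat \<Rightarrow> bit vec) \<Rightarrow> bit vec \<Rightarrow> nat set"
  where "support l b v = {i. coordinate l b v i \<noteq> 0}"

text \<open>The only nonzero scalar is 1, so the support retains all information about the
  coordinates.\<close>

lemma coordinate_eq_of_bool: "coordinate l b v i = of_bool (i \<in> support l b v)"
  using bit_eq_of_bool[of "coordinate l b v i"] by (simp add: support_def)

lemma support_sum_vec:
  assumes b: "F2_basis l b" and \<sigma>: "\<sigma> \<subseteq> {1..l}"
  shows "support l b (finsum_vec TYPE(bit) l b \<sigma>) = \<sigma>"
proof -
  interpret V: vec_space "TYPE(bit)" l .
  note C = F2_basisD(2)[OF b]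
  \<comment> \<open>Padding with zero coefficients gives a sum over all of \<open>{1..l}\<close>,
    the form in which \<open>coordinate_sum_vec\<close> applies.\<close>
  have "finsum_vec TYPE(bit) l b \<sigma> = finsum_vec TYPE(bit) l (\<lambda>i. of_bool (i \<in> \<sigma>) \<cdot>\<^sub>v b i) {1..l}"
  proof (rule eq_vecI)
    show "dim_vec (finsum_vec TYPE(bit) l b \<sigma>) =
        dim_vec (finsum_vec TYPE(bit) l (\<lambda>i. of_bool (i \<in> \<sigma>) \<cdot>\<^sub>v b i) {1..l})"
      using C \<sigma> finite_subset[OF \<sigma>] by (simp add: V.finsum_dim Pi_def subset_iff)
    fix k assume "k < dim_vec (finsum_vec TYPE(bit) l (\<lambda>i. of_bool (i \<in> \<sigma>) \<cdot>\<^sub>v b i) {1..l})"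
    then have k: "k < l" using C by (simp add: V.finsum_dim Pi_def)
    have "finsum_vec TYPE(bit) l b \<sigma> $ k = (\<Sum>i\<in>\<sigma>. b i $ k)"
      by (rule index_finsum_vec) (use C \<sigma> k in \<open>auto intro: finite_subset\<close>)
    also have "\<dots> = (\<Sum>i\<in>{1..l}. (of_bool (i \<in> \<sigma>) \<cdot>\<^sub>v b i) $ k)"
      by (rule sum.mono_neutral_cong_left) (use C \<sigma> k in auto)
    also have "\<dots> = finsum_vec TYPE(bit) l (\<lambda>i. of_bool (i \<in> \<sigma>) \<cdot>\<^sub>v b i) {1..l} $ k"
      by (rule index_finsum_vec[symmetric]) (use C k in auto)
    finally show "finsum_vec TYPE(bit) l b \<sigma> $ k =
      finsum_vec TYPE(bit) l (\<lambda>i. of_bool (i \<in> \<sigma>) \<cdot>\<^sub>v b i) {1..l} $ k" .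
  qed
  moreover have "coordinate l b (finsum_vec TYPE(bit) l (\<lambda>i. of_bool (i \<in> \<sigma>) \<cdot>\<^sub>v b i) {1..l}) =
      (\<lambda>i. of_bool (i \<in> \<sigma>))"
    by (rule coordinate_sum_vec[OF b]) (use \<sigma> in auto)
  ultimately show ?thesis by (simp add: support_def)
qed

text \<open>All scalars are 0 or 1, so a linear combination is the plain sum of the vectors whose
  coefficient is 1.\<close>

lemma coordinate_subspace_eq:
  assumes b: "F2_basis l b" and \<sigma>: "\<sigma> \<subseteq> {1..l}"
  shows "coordinate_subspace l b \<sigma> = finsum_vec TYPE(bit) l b ` Pow \<sigma>"
proof -
  interpret V: vec_space "TYPE(bit)" l .
  note C = F2_basisD(2)[OF b]
  have sum: "finsum_vec TYPE(bit) l b \<tau> = V.lincomb (\<lambda>_. 1) (b ` \<tau>)" if "\<tau> \<subseteq> \<sigma>" for \<tau>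
    using sum_vec_basis_eq_lincomb[OF b, of \<tau> "\<lambda>_. 1"] that \<sigma> by auto
  show ?thesis
  proof (intro equalityI subsetI)
    fix v assume "v \<in> coordinate_subspace l b \<sigma>"
    then obtain a A where v: "v = V.lincomb a A" and A: "finite A" "A \<subseteq> b ` \<sigma>"
      unfolding coordinate_subspace_def V.span_def by blast
    have AC: "A \<subseteq> carrier_vec l" using A(2) C \<sigma> by blast
    \<comment> \<open>On \<open>B\<close> every coefficient is 1, and the discarded vectors
      contribute nothing.\<close>
    define B where "B = {x \<in> A. a x \<noteq> 0}"
    obtain \<tau> where \<tau>: "\<tau> \<subseteq> \<sigma>" "B = b ` \<tau>"
      using A(2) by (metis (no_types, lifting) B_def mem_Collect_eq subset_iff subset_image_iff)
    have "V.lincomb a A = V.lincomb (\<lambda>_. 1) B"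
    proof (rule eq_vecI)
      have BC: "B \<subseteq> carrier_vec l" "finite B" using AC A by (auto simp: B_def)
      then show "dim_vec (V.lincomb a A) = dim_vec (V.lincomb (\<lambda>_. 1) B)"
        by (simp only: V.lincomb_dim A(1) AC)
      fix k assume "k < dim_vec (V.lincomb (\<lambda>_. 1) B)"
      then have k: "k < l" using V.lincomb_dim BC by simp
      show "V.lincomb a A $ k = V.lincomb (\<lambda>_. 1) B $ k"
        unfolding V.lincomb_index[OF k AC] V.lincomb_index[OF k BC(1)]
        by (rule sum.mono_neutral_cong_right) (use A(1) in \<open>auto simp: B_def\<close>)
    qed
    with v \<tau> sum show "v \<in> finsum_vec TYPE(bit) l b ` Pow \<sigma>" by auto
  next
    fix v assume "v \<in> finsum_vec TYPE(bit) l b ` Pow \<sigma>"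
    then obtain \<tau> where "\<tau> \<subseteq> \<sigma>" "v = V.lincomb (\<lambda>_. 1) (b ` \<tau>)" using sum by auto
    moreover have "finite (b ` \<tau>)" using \<sigma> \<open>\<tau> \<subseteq> \<sigma>\<close> by (meson finite_atLeastAtMost finite_imageI finite_subset)
    ultimately show "v \<in> coordinate_subspace l b \<sigma>"
      unfolding coordinate_subspace_def V.span_def by blast
  qed
qed

text \<open>The inverse sends a face to the sum of its basis vectors.\<close>

lemma bij_betw_support:
  assumes \<Delta>: "simplicial_complex l \<Delta>" and b: "F2_basis l b"
  shows "bij_betw (support l b) (arrangement_points (coordinate_arrangement l b \<Delta>)) \<Delta>"
proof -
  have sub: "\<sigma> \<subseteq> {1..l}" if "\<sigma> \<in> \<Delta>" for \<sigma>
    using \<Delta> that by (auto simp: simplicial_complex_def)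
  have "arrangement_points (coordinate_arrangement l b \<Delta>) =
      (\<Union>\<sigma>\<in>\<Delta>. finsum_vec TYPE(bit) l b ` Pow \<sigma>)"
    using coordinate_subspace_eq[OF b sub]
    by (simp add: arrangement_points_def coordinate_arrangement_def)
  also have "\<dots> = finsum_vec TYPE(bit) l b ` (\<Union>\<sigma>\<in>\<Delta>. Pow \<sigma>)" by blast
  \<comment> \<open>This is closure of \<Delta> under subsets.\<close>
  also have "(\<Union>\<sigma>\<in>\<Delta>. Pow \<sigma>) = \<Delta>"
    using \<Delta> by (auto simp: simplicial_complex_def)
  finally show ?thesis
    using support_sum_vec[OF b sub]
    by (intro bij_betwI[where g = "finsum_vec TYPE(bit) l b"]) auto
qed

section \<open>Values of polynomials at 0-1 points, and squarefree monomials\<close>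

lemma mpoly_eval_indicator:
  "mpoly_eval f (\<lambda>i. of_bool (i \<in> \<sigma>)) =
    (\<Sum>m\<in>Poly_Mapping.keys f. of_bool (Poly_Mapping.keys m \<subseteq> \<sigma>))"
  unfolding mpoly_eval_def
proof (rule sum.cong)
  fix m assume "m \<in> Poly_Mapping.keys f"
  then have "Poly_Mapping.lookup f m = 1"
    using bit_eq_of_bool[of "Poly_Mapping.lookup f m"] by (simp add: in_keys_iff)
  \<comment> \<open>Positive powers fix 0 and 1, so the value depends only on the set of variables
    of the monomial.\<close>
  moreover have "(\<Prod>i\<in>Poly_Mapping.keys m. of_bool (i \<in> \<sigma>) ^ Poly_Mapping.lookup m i) =
      (of_bool (Poly_Mapping.keys m \<subseteq> \<sigma>) :: bit)"
  proof (cases "Poly_Mapping.keys m \<subseteq> \<sigma>")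
    case True
    then show ?thesis by (auto intro!: prod.neutral)
  next
    case False
    then obtain i where "i \<in> Poly_Mapping.keys m" "i \<notin> \<sigma>" by blast
    \<comment> \<open>A key has a positive exponent, which excludes the case
      \<open>0 ^ 0 = 1\<close>.\<close>
    then have "\<exists>i\<in>Poly_Mapping.keys m. of_bool (i \<in> \<sigma>) ^ Poly_Mapping.lookup m i = (0 :: bit)"
      by (intro bexI[of _ i]) (auto simp: in_keys_iff)
    then show ?thesis using False by (simp add: prod_zero)
  qed
  ultimately show "Poly_Mapping.lookup f m *
      (\<Prod>i\<in>Poly_Mapping.keys m. of_bool (i \<in> \<sigma>) ^ Poly_Mapping.lookup m i) =
      of_bool (Poly_Mapping.keys m \<subseteq> \<sigma>)" by simp
qed simp

lemma total_degree_le_iff: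
  "total_degree f \<le> j \<longleftrightarrow> (\<forall>m\<in>Poly_Mapping.keys f. monomial_degree m \<le> j)"
  by (auto simp: total_degree_def)

text \<open>Each occurring variable has exponent at least 1. Hence replacing a monomial by the
  squarefree one with the same variables respects a degree bound.\<close>

lemma card_keys_le_monomial_degree: "card (Poly_Mapping.keys m) \<le> monomial_degree m"
proof -
  have "(\<Sum>i\<in>Poly_Mapping.keys m. 1) \<le> monomial_degree m"
    unfolding monomial_degree_def by (rule sum_mono) (simp add: in_keys_iff Suc_le_eq)
  then show ?thesis by simp
qed

text \<open>Serves at two levels: with values in \<open>nat\<close> it is the squarefree monomial on
  a set of variables, with values in \<open>bit\<close> the sum of a set of monomials. Finiteness of
  \<open>A\<close> ensures that \<open>Abs_poly_mapping\<close> is applied to a function of finite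
  support.\<close>

definition indicator_mapping :: "'a set \<Rightarrow> 'a \<Rightarrow>\<^sub>0 'b::{zero_neq_one}"
  where "indicator_mapping A = Abs_poly_mapping (\<lambda>x. of_bool (x \<in> A))"

lemma lookup_indicator_mapping:
  "finite A \<Longrightarrow> Poly_Mapping.lookup (indicator_mapping A) x = of_bool (x \<in> A)"
  by (simp add: indicator_mapping_def)

lemma keys_indicator_mapping:
  "finite A \<Longrightarrow> Poly_Mapping.keys (indicator_mapping A :: 'a \<Rightarrow>\<^sub>0 'b::{zero_neq_one}) = A"
  by (auto simp: in_keys_iff lookup_indicator_mapping)

lemma monomial_degree_indicator_mapping:
  "finite A \<Longrightarrow> monomial_degree (indicator_mapping A) = card A"
  by (simp add: monomial_degree_def keys_indicator_mapping lookup_indicator_mapping)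

section \<open>Incidence vectors of faces and the code they span\<close>

definition upset_vec :: "nat set list \<Rightarrow> nat set \<Rightarrow> bit vec"
  where "upset_vec ss \<tau> = vec (length ss) (\<lambda>k. of_bool (\<tau> \<subseteq> ss ! k))"

lemma upset_vec_carrier: "upset_vec ss \<tau> \<in> carrier_vec (length ss)"
  by (simp add: upset_vec_def)

lemma upset_vec_index: "k < length ss \<Longrightarrow> upset_vec ss \<tau> $ k = of_bool (\<tau> \<subseteq> ss ! k)"
  by (simp add: upset_vec_def)

text \<open>Comparing entries at the positions of \<sigma> and \<tau> themselves gives both
  inclusions.\<close>

lemma inj_on_upset_vec: "inj_on (upset_vec ss) (set ss)"
proof (rule inj_onI)
  fix \<sigma> \<tau> assume \<sigma>: "\<sigma> \<in> set ss" and \<tau>: "\<tau> \<in> set ss" and eq: "upset_vec ss \<sigma> = upset_vec ss \<tau>"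
  have "\<sigma> \<subseteq> ss ! k \<longleftrightarrow> \<tau> \<subseteq> ss ! k" if "k < length ss" for k
    using arg_cong[OF eq, of "\<lambda>v. v $ k"] that unfolding upset_vec_def
    by (simp only: index_vec of_bool_eq_iff)
  then show "\<sigma> = \<tau>"
    using \<sigma> \<tau> by (metis in_set_conv_nth subset_antisym subset_refl)
qed

lemma lincomb_upset_vec_index:
  assumes "F \<subseteq> set ss" "k < length ss"
  shows "LinearCombinations.module.lincomb (F2_space (length ss)) a (upset_vec ss ` F) $ k =
    (\<Sum>\<tau>\<in>F. a (upset_vec ss \<tau>) * of_bool (\<tau> \<subseteq> ss ! k))"
proof -
  interpret V: vec_space "TYPE(bit)" "length ss" .
  have "inj_on (upset_vec ss) F" using inj_on_upset_vec assms(1) by (rule inj_on_subset)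
  then show ?thesis
    using assms(2) upset_vec_carrier
    by (subst V.lincomb_index) (auto simp: sum.reindex upset_vec_index)
qed

text \<open>Unitriangularity becomes induction over proper subsets: at the position of \<tau> only
  subsets of \<tau> contribute, and the proper ones already have coefficient 0. Finiteness of the
  sets makes the induction well-founded.\<close>

lemma lin_indpt_upset_vec:
  assumes F: "F \<subseteq> set ss" and fin: "\<And>\<tau>. \<tau> \<in> F \<Longrightarrow> finite \<tau>"
  shows "LinearCombinations.module.lin_indpt F2 (F2_space (length ss)) (upset_vec ss ` F)"
proof -
  interpret V: vec_space "TYPE(bit)" "length ss" .
  have finF: "finite F" using F finite_subset by blast
  show ?thesis
  proof (rule V.finite_lin_indpt2)
    show "finite (upset_vec ss ` F)" "upset_vec ss ` F \<subseteq> carrier_vec (length ss)"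
      using finF upset_vec_carrier by auto
    fix a assume 0: "V.lincomb a (upset_vec ss ` F) = 0\<^sub>v (length ss)"
    have "a (upset_vec ss \<tau>) = 0" if "\<tau> \<in> F" for \<tau>
      using fin[OF that] that
    proof (induction \<tau> rule: finite_psubset_induct)
      case (psubset \<tau>)
      obtain k where k: "k < length ss" "ss ! k = \<tau>"
        using F psubset.prems by (meson in_set_conv_nth subsetD)
      have "0 = (\<Sum>\<rho>\<in>F. a (upset_vec ss \<rho>) * of_bool (\<rho> \<subseteq> \<tau>))"
        using lincomb_upset_vec_index[OF F k(1), of a] 0 k by simp
      \<comment> \<open>The induction hypothesis removes the proper subsets of \<tau>; the incidence
        factor removes the sets not contained in \<tau>.\<close>
      also have "\<dots> = (\<Sum>\<rho>\<in>{\<tau>}. a (upset_vec ss \<rho>) * of_bool (\<rho> \<subseteq> \<tau>))"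
        by (rule sum.mono_neutral_right) (use psubset finF in auto)
      finally show ?case by (cases "a (upset_vec ss \<tau>)") simp_all
    qed
    then show "\<forall>v\<in>upset_vec ss ` F. a v = 0" by blast
  qed
qed

text \<open>Entry \<open>k\<close> of a codeword belongs to the face \<open>ss ! k\<close>. For one
  inclusion, the monomials of a polynomial are grouped by their sets of variables; for the other, a
  combination of incidence vectors is realised by a sum of squarefree monomials.\<close>

lemma evaluation_code_eq_span:
  assumes \<Delta>: "simplicial_complex l \<Delta>"
    and ss: "ss = map (support l b) ps" "set ss = \<Delta>"
  shows "evaluation_code l b ps j = LinearCombinations.module.span F2 (F2_space (length ps))
    (upset_vec ss ` {\<tau> \<in> \<Delta>. card \<tau> \<le> j})"
proof -
  interpret V: vec_space "TYPE(bit)" "length ps" .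
  define F where "F = {\<tau> \<in> \<Delta>. card \<tau> \<le> j}"
  have len: "length ss = length ps" using ss by simp
  have F: "F \<subseteq> set ss" "finite F" using ss by (auto simp: F_def)
  have sub: "\<tau> \<subseteq> {1..l}" if "\<tau> \<in> \<Delta>" for \<tau>
    using \<Delta> that by (auto simp: simplicial_complex_def)
  have inj: "inj_on (upset_vec ss) F" using inj_on_upset_vec F(1) by (rule inj_on_subset)
  have UC: "upset_vec ss ` F \<subseteq> carrier_vec (length ps)" using upset_vec_carrier[of ss] len by auto
  define code where "code f = vec_of_list (map (\<lambda>p. mpoly_eval f (coordinate l b p)) ps)" for f
  have code_carrier: "dim_vec (code f) = length ps" for f by (simp add: code_def)
  have code_nth: "code f $ k = (\<Sum>m\<in>Poly_Mapping.keys f. of_bool (Poly_Mapping.keys m \<subseteq> ss ! k))"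
    if "k < length ps" for f k
  proof -
    have "coordinate l b (ps ! k) = (\<lambda>i. of_bool (i \<in> ss ! k))"
      using that ss by (auto simp: coordinate_eq_of_bool)
    then show ?thesis using that by (simp add: code_def vec_of_list_index mpoly_eval_indicator)
  qed
  have lincomb_nth: "V.lincomb a (upset_vec ss ` F) $ k =
      (\<Sum>\<tau>\<in>F. a (upset_vec ss \<tau>) * of_bool (\<tau> \<subseteq> ss ! k))" if "k < length ps" for a k
    using lincomb_upset_vec_index[OF F(1), of k a] that len by simp
  have span: "V.span (upset_vec ss ` F) = range (\<lambda>a. V.lincomb a (upset_vec ss ` F))"
    using V.finite_span[OF _ UC] F(2) by auto
  have "code ` {f. indeterminates f \<subseteq> {1..l} \<and> total_degree f \<le> j} = V.span (upset_vec ss ` F)"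
  proof (intro equalityI subsetI)
    fix v assume "v \<in> code ` {f. indeterminates f \<subseteq> {1..l} \<and> total_degree f \<le> j}"
    then obtain f where v: "v = code f" and deg: "total_degree f \<le> j" by blast
    \<comment> \<open>Every coefficient present is 1, so a group contributes its size modulo 2; for
      instance \<open>x\<close> and \<open>x^2\<close> cancel as functions.\<close>
    define c :: "nat set \<Rightarrow> bit" where
      "c \<tau> = of_nat (card {m \<in> Poly_Mapping.keys f. Poly_Mapping.keys m = \<tau>})" for \<tau>
    \<comment> \<open>Transfers the coefficients from faces to their vectors, using that
      \<open>upset_vec ss\<close> is injective on \<open>F\<close>.\<close>
    define a where "a = c \<circ> inv_into F (upset_vec ss)"
    have a: "a (upset_vec ss \<tau>) = c \<tau>" if "\<tau> \<in> F" for \<tau>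
      using inj that by (simp add: a_def)
    have "v = V.lincomb a (upset_vec ss ` F)"
    proof (rule eq_vecI)
      show dim: "dim_vec v = dim_vec (V.lincomb a (upset_vec ss ` F))"
        using V.lincomb_dim[OF _ UC] F(2) by (simp add: v code_carrier)
      fix k assume "k < dim_vec (V.lincomb a (upset_vec ss ` F))"
      then have k: "k < length ps" using dim by (simp add: v code_carrier)
      \<comment> \<open>A monomial that is nonzero at a point has its variables inside a face, hence
        they form a face themselves.\<close>
      have *: "Poly_Mapping.keys m \<in> F"
        if "m \<in> Poly_Mapping.keys f" "Poly_Mapping.keys m \<subseteq> ss ! k" for m
      proof -
        have "ss ! k \<in> \<Delta>" using ss k by (metis len nth_mem)
        with that have "Poly_Mapping.keys m \<in> \<Delta>"
          using \<Delta> by (auto simp: simplicial_complex_def)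
        moreover have "card (Poly_Mapping.keys m) \<le> j"
          using deg that card_keys_le_monomial_degree[of m] unfolding total_degree_le_iff by fastforce
        ultimately show ?thesis by (simp add: F_def)
      qed
      have "v $ k = (\<Sum>m\<in>Poly_Mapping.keys f. of_bool (Poly_Mapping.keys m \<subseteq> ss ! k))"
        by (simp add: v code_nth[OF k])
      also have "\<dots> = (\<Sum>m\<in>{m \<in> Poly_Mapping.keys f. Poly_Mapping.keys m \<in> F}.
          of_bool (Poly_Mapping.keys m \<subseteq> ss ! k))"
        by (rule sum.mono_neutral_right) (use * in auto)
      \<comment> \<open>The sum is split into the fibres of the map from a monomial to its set of
        variables.\<close>
      also have "\<dots> = (\<Sum>\<tau>\<in>F. \<Sum>m\<in>{m \<in> {m \<in> Poly_Mapping.keys f. Poly_Mapping.keys m \<in> F}.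
          Poly_Mapping.keys m = \<tau>}. of_bool (Poly_Mapping.keys m \<subseteq> ss ! k))"
        by (rule sum.group[symmetric]) (use F(2) in auto)
      also have "\<dots> = (\<Sum>\<tau>\<in>F. c \<tau> * of_bool (\<tau> \<subseteq> ss ! k))"
      proof (rule sum.cong)
        fix \<tau> assume "\<tau> \<in> F"
        then have "{m \<in> {m \<in> Poly_Mapping.keys f. Poly_Mapping.keys m \<in> F}. Poly_Mapping.keys m = \<tau>} =
            {m \<in> Poly_Mapping.keys f. Poly_Mapping.keys m = \<tau>}" by auto
        then show "(\<Sum>m\<in>{m \<in> {m \<in> Poly_Mapping.keys f. Poly_Mapping.keys m \<in> F}.
            Poly_Mapping.keys m = \<tau>}. of_bool (Poly_Mapping.keys m \<subseteq> ss ! k)) =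
            c \<tau> * of_bool (\<tau> \<subseteq> ss ! k)"
          by (simp add: c_def)
      qed simp
      also have "\<dots> = V.lincomb a (upset_vec ss ` F) $ k"
        using a by (simp add: lincomb_nth[OF k])
      finally show "v $ k = V.lincomb a (upset_vec ss ` F) $ k" .
    qed
    then show "v \<in> V.span (upset_vec ss ` F)" unfolding span by blast
  next
    fix v assume "v \<in> V.span (upset_vec ss ` F)"
    then obtain a where v: "v = V.lincomb a (upset_vec ss ` F)" unfolding span by blast
    \<comment> \<open>The coefficients that are not 0 equal 1, so the witness \<open>f\<close> is
      the sum of the squarefree monomials of the faces in \<open>G\<close>.\<close>
    define G where "G = {\<tau> \<in> F. a (upset_vec ss \<tau>) \<noteq> 0}"
    define M :: "(nat \<Rightarrow>\<^sub>0 nat) set" where "M = indicator_mapping ` G"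
    define f :: F2_mpoly where "f = indicator_mapping M"
    have finG: "finite G" using F(2) by (simp add: G_def)
    have finite_face: "finite \<tau>" and face: "\<tau> \<in> \<Delta>" "card \<tau> \<le> j" if "\<tau> \<in> G" for \<tau>
      using that sub by (auto simp: G_def F_def intro: finite_subset)
    have keys_f: "Poly_Mapping.keys f = M"
      using finG by (simp add: f_def M_def keys_indicator_mapping)
    have keys_mon: "Poly_Mapping.keys (indicator_mapping \<tau> :: nat \<Rightarrow>\<^sub>0 nat) = \<tau>" if "\<tau> \<in> G" for \<tau>
      using that finite_face by (simp add: keys_indicator_mapping)
    \<comment> \<open>Distinct faces give distinct monomials, so the sum over \<open>M\<close> can
      be reindexed by \<open>G\<close>.\<close>
    have inj_mon: "inj_on (indicator_mapping :: nat set \<Rightarrow> nat \<Rightarrow>\<^sub>0 nat) G"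
      by (rule inj_on_inverseI) (rule keys_mon)
    have "indeterminates f \<subseteq> {1..l}"
      unfolding indeterminates_def keys_f M_def using sub face(1) keys_mon by blast
    moreover have "total_degree f \<le> j"
      using face(2) finite_face
      by (auto simp: total_degree_le_iff keys_f M_def monomial_degree_indicator_mapping)
    moreover have "v = code f"
    proof (rule eq_vecI)
      show "dim_vec v = dim_vec (code f)"
        using V.lincomb_dim[OF _ UC] F(2) by (simp add: v code_carrier)
      fix k assume "k < dim_vec (code f)"
      then have k: "k < length ps" by (simp add: code_carrier)
      have "v $ k = (\<Sum>\<tau>\<in>F. a (upset_vec ss \<tau>) * of_bool (\<tau> \<subseteq> ss ! k))"
        by (simp add: v lincomb_nth[OF k])
      also have "\<dots> = (\<Sum>\<tau>\<in>G. of_bool (\<tau> \<subseteq> ss ! k))"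
        by (rule sum.mono_neutral_cong_right) (use F(2) in \<open>auto simp: G_def\<close>)
      also have "\<dots> = code f $ k"
        using inj_mon by (simp add: code_nth[OF k] keys_f M_def sum.reindex keys_mon)
      finally show "v $ k = code f $ k" .
    qed
    ultimately show "v \<in> code ` {f. indeterminates f \<subseteq> {1..l} \<and> total_degree f \<le> j}" by blast
  qed
  then show ?thesis by (simp add: evaluation_code_def code_def[abs_def] F_def)
qed

section \<open>Counting faces by size, and the dimension\<close>

lemma card_faces_le:
  assumes "finite \<Delta>"
  shows "card {\<tau> \<in> \<Delta>. card \<tau> \<le> j} = (\<Sum>i = 0..min j (Max (card ` \<Delta>)). face_number \<Delta> i)"
proof -
  have *: "card \<tau> \<le> Max (card ` \<Delta>)" if "\<tau> \<in> \<Delta>" for \<tau> using assms that by simp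
  then have "{\<tau> \<in> \<Delta>. card \<tau> \<le> j} = (\<Union>i\<in>{0..min j (Max (card ` \<Delta>))}. {\<tau> \<in> \<Delta>. card \<tau> = i})"
    by auto
  also have "card \<dots> = (\<Sum>i = 0..min j (Max (card ` \<Delta>)). card {\<tau> \<in> \<Delta>. card \<tau> = i})"
    by (rule card_UN_disjoint) (use assms in auto)
  finally show ?thesis by (simp add: face_number_def)
qed

theorem proposition1p7:
  fixes l j :: nat
    and \<Delta> :: "nat set set"
    and b :: "nat \<Rightarrow> bit vec"
    and ps :: "bit vec list"
  assumes "simplicial_complex l \<Delta>"
    and "F2_basis l b"
    and "distinct ps"
    and "set ps = arrangement_points (coordinate_arrangement l b \<Delta>)"
  shows "code_dimension (length ps) (evaluation_code l b ps j) =
    (\<Sum>i = 0..min j (Max (card ` \<Delta>)). face_number \<Delta> i)"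
proof -
  interpret V: vec_space "TYPE(bit)" "length ps" .
  define ss where "ss = map (support l b) ps"
  define F where "F = {\<tau> \<in> \<Delta>. card \<tau> \<le> j}"
  \<comment> \<open>Surjectivity of the support map onto \<Delta> makes every face occur in
    \<open>ss\<close>; this also shows that \<Delta> is finite.\<close>
  have ss: "set ss = \<Delta>" "length ss = length ps"
    using bij_betw_support[OF assms(1,2)] assms(4) by (auto simp: ss_def bij_betw_def)
  have F: "F \<subseteq> set ss" using ss by (auto simp: F_def)
  have "finite \<tau>" if "\<tau> \<in> F" for \<tau>
    using assms(1) that by (auto simp: F_def simplicial_complex_def intro: finite_subset)
  then have "V.lin_indpt (upset_vec ss ` F)"
    using lin_indpt_upset_vec[OF F] ss by simp
  moreover have "upset_vec ss ` F \<subseteq> carrier_vec (length ps)" "finite (upset_vec ss ` F)"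
    using upset_vec_carrier[of ss] ss F finite_subset[OF F] by auto
  ultimately have "vectorspace.dim F2 (V.span_vs (upset_vec ss ` F)) = card (upset_vec ss ` F)"
    using V.dim_span_lin_indpt by simp
  \<comment> \<open>Distinct faces have distinct incidence vectors, so counting vectors is counting
    faces.\<close>
  also have "\<dots> = card F"
    using inj_on_subset[OF inj_on_upset_vec F] by (rule card_image)
  also have "\<dots> = (\<Sum>i = 0..min j (Max (card ` \<Delta>)). face_number \<Delta> i)"
    unfolding F_def using card_faces_le ss by blast
  finally show ?thesis
    using evaluation_code_eq_span[OF assms(1) ss_def ss(1)] by (simp add: code_dimension_def F_def)
qed

end
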